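(* If $(R_1,\Longrightarrow^1)$ and $(R_2,\Longrightarrow^2)$ are reduction rings, then the direct sum $(R=R_1\times R_2,\longrightarrow)$, equipped with the componentwise reduction relation $\longrightarrow$ described in the context, is again a reduction ring.
   Context: Rings are associative, not necessarily commutative, with unit; "ideal" means two-sided ideal, and $\mathrm{ideal}_R(B)$ is the ideal generated by $B$. A reduction relation on a ring $R$ is a family of binary relations $\Longrightarrow_\beta$ on $R$, $\beta\in R$; for $B\subseteq R$ one has a relation $\Longrightarrow_B$. $\stackrel{*}{\Longleftrightarrow}_B$ is the reflexive symmetric transitive closure of $\Longrightarrow_B$. Axioms: (A1) $\Longrightarrow_B=\bigcup_{\beta\in B}\Longrightarrow_\beta$, and $\Longrightarrow_B$ is terminating for every finite $B\subseteq R$. (A2) $\alpha\Longrightarrow_\beta\gamma$ implies $\alpha-\gamma\in\mathrm{ideal}_R(\{\beta\})$. (A3) $\alpha\Longrightarrow_\alpha 0$ for all $\alpha\in R\setminus\{0\}$. A subset $B\subseteq R$ is a Gröbner basis of $\mathfrak i=\mathrm{ideal}_R(B)$ if $\stackrel{*}{\Longleftrightarrow}_B$ equals the congruence $\equiv_{\mathfrak i}$ ($\alpha\equiv_{\mathfrak i}\beta$ iff $\alpha-\beta\in\mathfrak i$) and $\Longrightarrow_B$ is complete (terminating and confluent). $(R,\Longrightarrow)$ satisfying (A1)–(A3) is a reduction ring if every finitely generated ideal has a finite Gröbner basis. Direct sum: $R=R_1\times R_2$ with componentwise addition and multiplication and unit $(1_1,1_2)$. For $\alpha=(\alpha_1,\alpha_2)$,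 $\beta=(\beta_1,\beta_2)$, $\gamma=(\gamma_1,\gamma_2)$ in $R$ put $\alpha\longrightarrow_\beta\gamma$ iff either ($\alpha_1\Longrightarrow^1_{\beta_1}\gamma_1$ and $\alpha_2=\gamma_2$), or ($\alpha_1=\gamma_1$ and $\alpha_2\Longrightarrow^2_{\beta_2}\gamma_2$), or ($\alpha_1\Longrightarrow^1_{\beta_1}\gamma_1$ and $\alpha_2\Longrightarrow^2_{\beta_2}\gamma_2$); $\longrightarrow_B=\bigcup_{\beta\in B}\longrightarrow_\beta$. *)

theory Defs
  imports "HOL-Algebra.Algebra" "HOL-Library.Confluence"
begin

text \<open>
  A family of relations is a curried predicate: \<open>red \<beta> \<alpha> \<gamma>\<close> reads
  ``\<open>\<alpha>\<close> reduces to \<open>\<gamma>\<close> using \<open>\<beta>\<close>''.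
\<close>

definition red_set :: "('a \<Rightarrow> 'a \<Rightarrow> 'a \<Rightarrow> bool) \<Rightarrow> 'a set \<Rightarrow> 'a \<Rightarrow> 'a \<Rightarrow> bool" where
  "red_set red B \<alpha> \<gamma> \<longleftrightarrow> (\<exists>\<beta>\<in>B. red \<beta> \<alpha> \<gamma>)"

definition terminating :: "('a \<Rightarrow> 'a \<Rightarrow> bool) \<Rightarrow> bool" where
  "terminating r \<longleftrightarrow> (\<nexists>f :: nat \<Rightarrow> 'a. \<forall>n. r (f n) (f (Suc n)))"

definition complete_red :: "('a \<Rightarrow> 'a \<Rightarrow> bool) \<Rightarrow> bool" where
  "complete_red r \<longleftrightarrow> terminating r \<and> confluentp r"

text \<open>
  The type may be larger than the carrier; \<open>red_closed\<close> says that each \<open>red \<beta>\<close>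
  is a relation on the carrier. Elements outside the carrier are then isolated, so termination
  and confluence on the type agree with termination and confluence on the carrier.
\<close>

locale reduction_relation = ring R for R (structure) +
  fixes red :: "'a \<Rightarrow> 'a \<Rightarrow> 'a \<Rightarrow> bool"
  assumes red_closed:
      "\<lbrakk>\<beta> \<in> carrier R; red \<beta> \<alpha> \<gamma>\<rbrakk> \<Longrightarrow> \<alpha> \<in> carrier R \<and> \<gamma> \<in> carrier R"
    and red_terminating:
      "\<lbrakk>B \<subseteq> carrier R; finite B\<rbrakk> \<Longrightarrow> terminating (red_set red B)"
    and red_diff_in_ideal:
      "\<lbrakk>\<beta> \<in> carrier R; red \<beta> \<alpha> \<gamma>\<rbrakk> \<Longrightarrow> \<alpha> \<ominus> \<gamma> \<in> Idl {\<beta>}"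
    and red_self_zero:
      "\<alpha> \<in> carrier R - {\<zero>} \<Longrightarrow> red \<alpha> \<alpha> \<zero>"

definition groebner_basis ::
    "('a, 'm) ring_scheme \<Rightarrow> ('a \<Rightarrow> 'a \<Rightarrow> 'a \<Rightarrow> bool) \<Rightarrow> 'a set \<Rightarrow> 'a set \<Rightarrow> bool" where
  "groebner_basis R red B I \<longleftrightarrow>
     B \<subseteq> carrier R \<and> I = Idl\<^bsub>R\<^esub> B \<and>
     (\<forall>\<alpha>\<in>carrier R. \<forall>\<beta>\<in>carrier R. equivclp (red_set red B) \<alpha> \<beta> \<longleftrightarrow> \<alpha> \<ominus>\<^bsub>R\<^esub> \<beta> \<in> I) \<and>
     complete_red (red_set red B)"

locale reduction_ring = reduction_relation +
  assumes finite_groebner_basis: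
    "\<lbrakk>F \<subseteq> carrier R; finite F\<rbrakk> \<Longrightarrow> \<exists>G. finite G \<and> groebner_basis R red G (Idl F)"

text \<open>
  The carrier conditions are needed because of the components that stay unchanged: they make
  the result a relation on \<open>carrier R1 \<times> carrier R2\<close>.
\<close>

definition prod_red ::
    "('a, 'm) ring_scheme \<Rightarrow> ('b, 'n) ring_scheme \<Rightarrow>
     ('a \<Rightarrow> 'a \<Rightarrow> 'a \<Rightarrow> bool) \<Rightarrow> ('b \<Rightarrow> 'b \<Rightarrow> 'b \<Rightarrow> bool) \<Rightarrow>
     'a \<times> 'b \<Rightarrow> 'a \<times> 'b \<Rightarrow> 'a \<times> 'b \<Rightarrow> bool" where
  "prod_red R1 R2 red1 red2 \<beta> \<alpha> \<gamma> \<longleftrightarrow>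
     \<alpha> \<in> carrier (RDirProd R1 R2) \<and> \<gamma> \<in> carrier (RDirProd R1 R2) \<and>
     (red1 (fst \<beta>) (fst \<alpha>) (fst \<gamma>) \<and> snd \<alpha> = snd \<gamma> \<or>
      fst \<alpha> = fst \<gamma> \<and> red2 (snd \<beta>) (snd \<alpha>) (snd \<gamma>) \<or>
      red1 (fst \<beta>) (fst \<alpha>) (fst \<gamma>) \<and> red2 (snd \<beta>) (snd \<alpha>) (snd \<gamma>))"

end

theory Submission
  imports Defs
begin

text \<open>
  An ideal of \<open>R1 \<times> R2\<close> generated by \<open>B\<close> is the product of the ideals generated by the two
  projections of \<open>B\<close>. If \<open>G1\<close> and \<open>G2\<close> are Groebner bases in the components, then
  \<open>G1 \<times> {0} \<union> {0} \<times> G2\<close> is one in the product: as \<open>0\<close> reduces nothing, its reduction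
  relation rewrites exactly one component at a time, so that reachability, convertibility and
  confluence all decompose componentwise. Termination for an arbitrary finite set holds because
  every step decreases the lexicographic product of the component relations.
\<close>

section \<open>Relations on products\<close>

text \<open>Exactly one coordinate moves in each step. The membership guards on the resting
  coordinate play the part of the carrier conditions in \<open>prod_red\<close>: without them,
  points outside \<open>A \<times> B\<close> could still move.\<close>

definition interleave ::
    "'a set \<Rightarrow> 'b set \<Rightarrow> ('a \<Rightarrow> 'a \<Rightarrow> bool) \<Rightarrow> ('b \<Rightarrow> 'b \<Rightarrow> bool) \<Rightarrow> 'a \<times> 'b \<Rightarrow> 'a \<times> 'b \<Rightarrow> bool" where
  "interleave A B r s x y \<longleftrightarrow>
     r (fst x) (fst y) \<and> snd x = snd y \<and> snd x \<in> B \<or>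
     fst x = fst y \<and> fst x \<in> A \<and> s (snd x) (snd y)"

definition relation_on :: "'a set \<Rightarrow> ('a \<Rightarrow> 'a \<Rightarrow> bool) \<Rightarrow> bool" where
  "relation_on A r \<longleftrightarrow> (\<forall>x y. r x y \<longrightarrow> x \<in> A \<and> y \<in> A)"

lemma relation_on_symclp: "relation_on A r \<Longrightarrow> relation_on A (symclp r)"
  by (auto simp: relation_on_def symclp_def)

lemma relation_on_rtranclp: "r\<^sup>*\<^sup>* x y \<Longrightarrow> relation_on A r \<Longrightarrow> x \<in> A \<Longrightarrow> y \<in> A"
  by (induction rule: rtranclp_induct) (auto simp: relation_on_def)

text \<open>The guard concerns the resting coordinate, which source and target share, so reversing a
  step preserves it. Convertibility thereby becomes reachability in another interleaving.\<close>

lemma symclp_interleave: "symclp (interleave A B r s) = interleave A B (symclp r) (symclp s)"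
  by (intro ext) (auto simp: symclp_def interleave_def)

lemma rtranclp_interleaveD:
  assumes "(interleave A B r s)\<^sup>*\<^sup>* x y"
  shows "r\<^sup>*\<^sup>* (fst x) (fst y) \<and> s\<^sup>*\<^sup>* (snd x) (snd y)"
  using assms
  by (induction rule: rtranclp_induct) (auto simp: interleave_def intro: rtranclp.rtrancl_into_rtrancl)

lemma rtranclp_interleave_fst:
  "r\<^sup>*\<^sup>* a c \<Longrightarrow> b \<in> B \<Longrightarrow> (interleave A B r s)\<^sup>*\<^sup>* (a, b) (c, b)"
  by (induction rule: rtranclp_induct)
    (auto simp: interleave_def intro: rtranclp.rtrancl_into_rtrancl)

lemma rtranclp_interleave_snd:
  "s\<^sup>*\<^sup>* b d \<Longrightarrow> a \<in> A \<Longrightarrow> (interleave A B r s)\<^sup>*\<^sup>* (a, b) (a, d)"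
  by (induction rule: rtranclp_induct)
    (auto simp: interleave_def intro: rtranclp.rtrancl_into_rtrancl)

text \<open>Moves in different coordinates are independent, so all moves of the first coordinate can
  be made before those of the second. \<open>relation_on A r\<close> keeps the intermediate point
  \<open>(fst y, snd x)\<close> inside \<open>A \<times> B\<close>, where the second phase may
  start.\<close>

lemma rtranclp_interleave_iff:
  assumes r: "relation_on A r" and x: "x \<in> A \<times> B"
  shows "(interleave A B r s)\<^sup>*\<^sup>* x y \<longleftrightarrow> r\<^sup>*\<^sup>* (fst x) (fst y) \<and> s\<^sup>*\<^sup>* (snd x) (snd y)"
proof
  assume rs: "r\<^sup>*\<^sup>* (fst x) (fst y) \<and> s\<^sup>*\<^sup>* (snd x) (snd y)"
  have "(interleave A B r s)\<^sup>*\<^sup>* (fst x, snd x) (fst y, snd x)"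
    using rs x by (intro rtranclp_interleave_fst) auto
  also have "(interleave A B r s)\<^sup>*\<^sup>* (fst y, snd x) (fst y, snd y)"
    using rs x relation_on_rtranclp[OF _ r] by (intro rtranclp_interleave_snd) auto
  finally show "(interleave A B r s)\<^sup>*\<^sup>* x y"
    by simp
qed (rule rtranclp_interleaveD)

lemma equivclp_interleave_iff:
  assumes "relation_on A r" and "x \<in> A \<times> B"
  shows "equivclp (interleave A B r s) x y \<longleftrightarrow>
    equivclp r (fst x) (fst y) \<and> equivclp s (snd x) (snd y)"
  unfolding equivclp_def symclp_interleave
  using rtranclp_interleave_iff[OF relation_on_symclp] assms by blast

text \<open>A common descendant is found in each coordinate separately, and the pair of the two
  joins \<open>y\<close> and \<open>z\<close>.\<close>

lemma confluentp_interleave: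
  assumes r: "relation_on A r" and s: "relation_on B s"
    and cr: "confluentp r" and cs: "confluentp s"
  shows "confluentp (interleave A B r s)"
proof (rule confluentpI)
  fix x y z
  assume y: "(interleave A B r s)\<^sup>*\<^sup>* x y" and z: "(interleave A B r s)\<^sup>*\<^sup>* x z"
  show "\<exists>u. (interleave A B r s)\<^sup>*\<^sup>* y u \<and> (interleave A B r s)\<^sup>*\<^sup>* z u"
  proof (cases "x \<in> A \<times> B")
    case True
    note y' = rtranclp_interleaveD[OF y] and z' = rtranclp_interleaveD[OF z]
    obtain u where u: "r\<^sup>*\<^sup>* (fst y) u" "r\<^sup>*\<^sup>* (fst z) u"
      using confluentpD[OF cr] y' z' by blast
    obtain v where v: "s\<^sup>*\<^sup>* (snd y) v" "s\<^sup>*\<^sup>* (snd z) v"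
      using confluentpD[OF cs] y' z' by blast
    \<comment> \<open>The componentwise description of reachability is about to be used with
      \<open>y\<close> and \<open>z\<close> as starting points, so both must lie in
      \<open>A \<times> B\<close>.\<close>
    have "w \<in> A \<times> B" if "r\<^sup>*\<^sup>* (fst x) (fst w) \<and> s\<^sup>*\<^sup>* (snd x) (snd w)" for w
      using that True relation_on_rtranclp[of r "fst x" "fst w", OF _ r]
        relation_on_rtranclp[of s "snd x" "snd w", OF _ s]
      by (simp add: mem_Times_iff)
    with y' z' have "y \<in> A \<times> B" "z \<in> A \<times> B"
      by blast+
    then show ?thesis
      using u v by (intro exI[of _ "(u, v)"]) (simp add: rtranclp_interleave_iff[OF r])
  next
    case False
    \<comment> \<open>A point outside \<open>A \<times> B\<close> is isolated, so \<open>y\<close>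
      is \<open>x\<close> itself and \<open>z\<close> serves as the common descendant.\<close>
    then have "\<not> interleave A B r s x w" for w
      using r s by (auto simp: interleave_def relation_on_def mem_Times_iff)
    with y have "y = x"
      by (cases rule: converse_rtranclpE) auto
    then show ?thesis
      using z by blast
  qed
qed

lemma terminating_iff_wf: "terminating r \<longleftrightarrow> wf {(y, x). r x y}"
  by (simp add: terminating_def wf_iff_no_infinite_down_chain)

text \<open>In the lexicographic order the second coordinate may change arbitrarily whenever the
  first one decreases. This is what absorbs the steps that move both coordinates at once.\<close>

lemma terminating_lex:
  assumes "terminating r" and "terminating s"
    and "\<And>x y. t x y \<Longrightarrow> r (fst x) (fst y) \<or> fst x = fst y \<and> s (snd x) (snd y)"
  shows "terminating t"
proof -
  have "wf ({(y, x). r x y} <*lex*> {(y, x). s x y})"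
    using assms(1,2) by (simp add: terminating_iff_wf wf_lex_prod)
  moreover have "{(y, x). t x y} \<subseteq> {(y, x). r x y} <*lex*> {(y, x). s x y}"
    using assms(3) by force
  ultimately show ?thesis
    unfolding terminating_iff_wf by (rule wf_subset)
qed

section \<open>Ideals of a direct product\<close>

lemma RDirProd_zero: "\<zero>\<^bsub>RDirProd R S\<^esub> = (\<zero>\<^bsub>R\<^esub>, \<zero>\<^bsub>S\<^esub>)"
  by (simp add: RDirProd_def DirProd_def monoid.defs)

lemma RDirProd_add: "x \<oplus>\<^bsub>RDirProd R S\<^esub> y = (fst x \<oplus>\<^bsub>R\<^esub> fst y, snd x \<oplus>\<^bsub>S\<^esub> snd y)"
  by (simp add: RDirProd_def DirProd_def monoid.defs case_prod_unfold)

lemma RDirProd_mult: "x \<otimes>\<^bsub>RDirProd R S\<^esub> y = (fst x \<otimes>\<^bsub>R\<^esub> fst y, snd x \<otimes>\<^bsub>S\<^esub> snd y)"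
  by (simp add: RDirProd_def DirProd_def monoid.defs case_prod_unfold)

context
  fixes R (structure) and S (structure)
  assumes R: "ring R" and S: "ring S"
begin

interpretation R: ring R by (rule R)
interpretation S: ring S by (rule S)
interpretation RS: ring "RDirProd R S" by (rule RDirProd_ring[OF R S])

lemma RDirProd_uminus:
  assumes "x \<in> carrier R \<times> carrier S"
  shows "\<ominus>\<^bsub>RDirProd R S\<^esub> x = (\<ominus>\<^bsub>R\<^esub> fst x, \<ominus>\<^bsub>S\<^esub> snd x)"
  \<comment> \<open>Negation is inversion in the additive monoid, and the additive monoid of the
    product is the direct product of the two additive groups.\<close>
  unfolding a_inv_def RDirProd_add_monoid
  using assms inv_DirProd[OF R.add.is_group S.add.is_group, of "fst x" "snd x"] by auto

lemma RDirProd_minus: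
  assumes "x \<in> carrier R \<times> carrier S" and "y \<in> carrier R \<times> carrier S"
  shows "x \<ominus>\<^bsub>RDirProd R S\<^esub> y = (fst x \<ominus>\<^bsub>R\<^esub> fst y, snd x \<ominus>\<^bsub>S\<^esub> snd y)"
  using assms by (simp add: a_minus_def RDirProd_add RDirProd_uminus)

lemma ideal_Times:
  assumes I: "ideal I R" and J: "ideal J S"
  shows "ideal (I \<times> J) (RDirProd R S)"
proof -
  interpret I: ideal I R by (rule I)
  interpret J: ideal J S by (rule J)
  show ?thesis
  proof (rule idealI[OF RS.ring_axioms])
    show "subgroup (I \<times> J) (add_monoid (RDirProd R S))"
      unfolding RDirProd_add_monoid
      by (intro DirProd_subgroups R.add.is_group S.add.is_group I.a_subgroup J.a_subgroup)
  qed (auto simp: RDirProd_carrier RDirProd_mult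
      I.I_l_closed I.I_r_closed J.I_l_closed J.I_r_closed)
qed

text \<open>This set is the preimage of \<open>J\<close> under the embedding of \<open>R\<close> as
  the first axis. The embedding respects sums, negatives and products but in general not the unit,
  so the ideal laws are checked directly, multiplying by elements \<open>(x, 0)\<close>.\<close>

lemma ideal_fst_section:
  assumes J: "ideal J (RDirProd R S)"
  shows "ideal {x. (x, \<zero>\<^bsub>S\<^esub>) \<in> J} R"
proof -
  interpret J: ideal J "RDirProd R S" by (rule J)
  have c: "x \<in> carrier R" if "(x, \<zero>\<^bsub>S\<^esub>) \<in> J" for x
    using J.Icarr[OF that] by (simp add: RDirProd_carrier)
  show ?thesis
  proof (rule idealI[OF R])
    show "subgroup {x. (x, \<zero>\<^bsub>S\<^esub>) \<in> J} (add_monoid R)"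
    proof (rule R.add.subgroupI)
      show "{x. (x, \<zero>\<^bsub>S\<^esub>) \<in> J} \<noteq> {}"
        using J.zero_closed by (auto simp: RDirProd_zero)
    next
      fix x assume "x \<in> {x. (x, \<zero>\<^bsub>S\<^esub>) \<in> J}"
      then show "\<ominus>\<^bsub>R\<^esub> x \<in> {x. (x, \<zero>\<^bsub>S\<^esub>) \<in> J}"
        using J.a_inv_closed[of "(x, \<zero>\<^bsub>S\<^esub>)"] c[of x] by (simp add: RDirProd_uminus)
    next
      fix x y assume "x \<in> {x. (x, \<zero>\<^bsub>S\<^esub>) \<in> J}" "y \<in> {x. (x, \<zero>\<^bsub>S\<^esub>) \<in> J}"
      then show "x \<oplus>\<^bsub>R\<^esub> y \<in> {x. (x, \<zero>\<^bsub>S\<^esub>) \<in> J}"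
        using J.a_closed[of "(x, \<zero>\<^bsub>S\<^esub>)" "(y, \<zero>\<^bsub>S\<^esub>)"] by (simp add: RDirProd_add)
    qed (use c in auto)
  next
    fix a x assume a: "a \<in> {x. (x, \<zero>\<^bsub>S\<^esub>) \<in> J}" and x: "x \<in> carrier R"
    show "x \<otimes>\<^bsub>R\<^esub> a \<in> {x. (x, \<zero>\<^bsub>S\<^esub>) \<in> J}"
      using a x J.I_l_closed[of "(a, \<zero>\<^bsub>S\<^esub>)" "(x, \<zero>\<^bsub>S\<^esub>)"]
      by (simp add: RDirProd_mult RDirProd_carrier)
    show "a \<otimes>\<^bsub>R\<^esub> x \<in> {x. (x, \<zero>\<^bsub>S\<^esub>) \<in> J}"
      using a x J.I_r_closed[of "(a, \<zero>\<^bsub>S\<^esub>)" "(x, \<zero>\<^bsub>S\<^esub>)"]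
      by (simp add: RDirProd_mult RDirProd_carrier)
  qed
qed

lemma ideal_snd_section:
  assumes J: "ideal J (RDirProd R S)"
  shows "ideal {y. (\<zero>\<^bsub>R\<^esub>, y) \<in> J} S"
proof -
  interpret J: ideal J "RDirProd R S" by (rule J)
  have c: "y \<in> carrier S" if "(\<zero>\<^bsub>R\<^esub>, y) \<in> J" for y
    using J.Icarr[OF that] by (simp add: RDirProd_carrier)
  show ?thesis
  proof (rule idealI[OF S])
    show "subgroup {y. (\<zero>\<^bsub>R\<^esub>, y) \<in> J} (add_monoid S)"
    proof (rule S.add.subgroupI)
      show "{y. (\<zero>\<^bsub>R\<^esub>, y) \<in> J} \<noteq> {}"
        using J.zero_closed by (auto simp: RDirProd_zero)
    next
      fix y assume "y \<in> {y. (\<zero>\<^bsub>R\<^esub>, y) \<in> J}"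
      then show "\<ominus>\<^bsub>S\<^esub> y \<in> {y. (\<zero>\<^bsub>R\<^esub>, y) \<in> J}"
        using J.a_inv_closed[of "(\<zero>\<^bsub>R\<^esub>, y)"] c[of y] by (simp add: RDirProd_uminus)
    next
      fix x y assume "x \<in> {y. (\<zero>\<^bsub>R\<^esub>, y) \<in> J}" "y \<in> {y. (\<zero>\<^bsub>R\<^esub>, y) \<in> J}"
      then show "x \<oplus>\<^bsub>S\<^esub> y \<in> {y. (\<zero>\<^bsub>R\<^esub>, y) \<in> J}"
        using J.a_closed[of "(\<zero>\<^bsub>R\<^esub>, x)" "(\<zero>\<^bsub>R\<^esub>, y)"] by (simp add: RDirProd_add)
    qed (use c in auto)
  next
    fix a x assume a: "a \<in> {y. (\<zero>\<^bsub>R\<^esub>, y) \<in> J}" and x: "x \<in> carrier S"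
    show "x \<otimes>\<^bsub>S\<^esub> a \<in> {y. (\<zero>\<^bsub>R\<^esub>, y) \<in> J}"
      using a x J.I_l_closed[of "(\<zero>\<^bsub>R\<^esub>, a)" "(\<zero>\<^bsub>R\<^esub>, x)"]
      by (simp add: RDirProd_mult RDirProd_carrier)
    show "a \<otimes>\<^bsub>S\<^esub> x \<in> {y. (\<zero>\<^bsub>R\<^esub>, y) \<in> J}"
      using a x J.I_r_closed[of "(\<zero>\<^bsub>R\<^esub>, a)" "(\<zero>\<^bsub>R\<^esub>, x)"]
      by (simp add: RDirProd_mult RDirProd_carrier)
  qed
qed

text \<open>One inclusion is minimality, the product of two ideals being an ideal. For the other,
  the idempotents \<open>(1, 0)\<close> and \<open>(0, 1)\<close> split every generator into its two
  axis parts; minimality on each axis then covers both factors, and sums of axis elements give the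
  whole product.\<close>

lemma genideal_RDirProd:
  assumes B: "B \<subseteq> carrier R \<times> carrier S"
  shows "Idl\<^bsub>RDirProd R S\<^esub> B = (Idl\<^bsub>R\<^esub> (fst ` B)) \<times> (Idl\<^bsub>S\<^esub> (snd ` B))"
proof
  have B1: "fst ` B \<subseteq> carrier R" and B2: "snd ` B \<subseteq> carrier S" and B': "B \<subseteq> carrier (RDirProd R S)"
    using B by (auto simp: RDirProd_carrier)
  have "B \<subseteq> (Idl\<^bsub>R\<^esub> (fst ` B)) \<times> (Idl\<^bsub>S\<^esub> (snd ` B))"
    using R.genideal_self[OF B1] S.genideal_self[OF B2] by (auto simp: mem_Times_iff)
  then show "Idl\<^bsub>RDirProd R S\<^esub> B \<subseteq> (Idl\<^bsub>R\<^esub> (fst ` B)) \<times> (Idl\<^bsub>S\<^esub> (snd ` B))"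
    by (intro RS.genideal_minimal ideal_Times R.genideal_ideal S.genideal_ideal B1 B2)
  let ?J = "Idl\<^bsub>RDirProd R S\<^esub> B"
  interpret J: ideal ?J "RDirProd R S"
    by (rule RS.genideal_ideal[OF B'])
  have BJ: "B \<subseteq> ?J"
    by (rule RS.genideal_self[OF B'])
  have sections: "(fst b, \<zero>\<^bsub>S\<^esub>) \<in> ?J" "(\<zero>\<^bsub>R\<^esub>, snd b) \<in> ?J" if "b \<in> B" for b
  proof -
    have b: "b \<in> ?J" "fst b \<in> carrier R" "snd b \<in> carrier S"
      using that BJ B by auto
    \<comment> \<open>Multiplying \<open>b\<close> by the idempotent \<open>(1, 0)\<close> erases
      the second coordinate.\<close>
    show "(fst b, \<zero>\<^bsub>S\<^esub>) \<in> ?J"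
      using b J.I_l_closed[OF b(1), of "(\<one>\<^bsub>R\<^esub>, \<zero>\<^bsub>S\<^esub>)"]
      by (simp add: RDirProd_mult RDirProd_carrier)
    show "(\<zero>\<^bsub>R\<^esub>, snd b) \<in> ?J"
      using b J.I_l_closed[OF b(1), of "(\<zero>\<^bsub>R\<^esub>, \<one>\<^bsub>S\<^esub>)"]
      by (simp add: RDirProd_mult RDirProd_carrier)
  qed
  have sub1: "Idl\<^bsub>R\<^esub> (fst ` B) \<subseteq> {x. (x, \<zero>\<^bsub>S\<^esub>) \<in> ?J}"
    using sections by (intro R.genideal_minimal ideal_fst_section J.is_ideal) auto
  have sub2: "Idl\<^bsub>S\<^esub> (snd ` B) \<subseteq> {y. (\<zero>\<^bsub>R\<^esub>, y) \<in> ?J}"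
    using sections by (intro S.genideal_minimal ideal_snd_section J.is_ideal) auto
  show "(Idl\<^bsub>R\<^esub> (fst ` B)) \<times> (Idl\<^bsub>S\<^esub> (snd ` B)) \<subseteq> ?J"
  proof
    fix z
    assume "z \<in> (Idl\<^bsub>R\<^esub> (fst ` B)) \<times> (Idl\<^bsub>S\<^esub> (snd ` B))"
    then have J: "(fst z, \<zero>\<^bsub>S\<^esub>) \<in> ?J" "(\<zero>\<^bsub>R\<^esub>, snd z) \<in> ?J"
      using sub1 sub2 by auto
    \<comment> \<open>Carrier membership lets the zeros cancel in the decomposition of
      \<open>z\<close> as \<open>(fst z, 0)\<close> plus \<open>(0, snd z)\<close>.\<close>
    then have "fst z \<in> carrier R" "snd z \<in> carrier S"
      using J.Icarr by (fastforce simp: RDirProd_carrier)+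
    then show "z \<in> ?J"
      using J.a_closed[OF J] by (simp add: RDirProd_add)
  qed
qed

end

text \<open>Projecting a set of axis elements to one coordinate may add 0 to the generators; this
  removes it again.\<close>

lemma (in ring) genideal_insert_zero:
  assumes "A \<subseteq> carrier R"
  shows "Idl (insert \<zero> A) = Idl A"
proof -
  interpret I: ideal "Idl A" R by (rule genideal_ideal[OF assms])
  show ?thesis
    using assms genideal_self[OF assms] I.zero_closed
    by (intro equalityI genideal_minimal subset_Idl_subset I.is_ideal) (auto intro: genideal_self)
qed

section \<open>Reduction relations on a direct product\<close>

context reduction_relation
begin

text \<open>The ideal generated by 0 is trivial, so such a step would have equal source and target.
  Repeating it forever contradicts termination for the finite set consisting of 0.\<close>

lemma not_red_zero: "\<not> red \<zero> \<alpha> \<gamma>"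
proof
  assume red: "red \<zero> \<alpha> \<gamma>"
  then have "\<alpha> \<in> carrier R" "\<gamma> \<in> carrier R" "\<alpha> \<ominus> \<gamma> = \<zero>"
    using red_closed[OF zero_closed red] red_diff_in_ideal[OF zero_closed red]
    by (simp_all add: genideal_zero)
  then have "\<alpha> = \<gamma>"
    by simp
  then show False
    using red red_terminating[of "{\<zero>}"] by (auto simp: terminating_def red_set_def)
qed

lemma relation_on_red_set: "B \<subseteq> carrier R \<Longrightarrow> relation_on (carrier R) (red_set red B)"
  unfolding relation_on_def red_set_def using red_closed by blast

end

lemma reduction_relation_prod_red:
  assumes "reduction_relation R1 red1" and "reduction_relation R2 red2"
  shows "reduction_relation (RDirProd R1 R2) (prod_red R1 R2 red1 red2)"
proof -
  interpret R1: reduction_relation R1 red1 by fact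
  interpret R2: reduction_relation R2 red2 by fact
  interpret P: ring "RDirProd R1 R2"
    by (rule RDirProd_ring[OF R1.ring_axioms R2.ring_axioms])
  show ?thesis
  proof
    fix \<beta> \<alpha> \<gamma>
    assume "prod_red R1 R2 red1 red2 \<beta> \<alpha> \<gamma>"
    then show "\<alpha> \<in> carrier (RDirProd R1 R2) \<and> \<gamma> \<in> carrier (RDirProd R1 R2)"
      by (simp add: prod_red_def)
  next
    fix B
    assume B: "B \<subseteq> carrier (RDirProd R1 R2)" "finite B"
    \<comment> \<open>The projections of a finite set are finite, so both component relations
      terminate and the lexicographic argument applies.\<close>
    then have "terminating (red_set red1 (fst ` B))" "terminating (red_set red2 (snd ` B))"
      by (auto intro!: R1.red_terminating R2.red_terminating simp: RDirProd_carrier)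
    then show "terminating (red_set (prod_red R1 R2 red1 red2) B)"
      by (rule terminating_lex) (auto simp: red_set_def prod_red_def)
  next
    fix \<beta> \<alpha> \<gamma>
    assume \<beta>: "\<beta> \<in> carrier (RDirProd R1 R2)" and red: "prod_red R1 R2 red1 red2 \<beta> \<alpha> \<gamma>"
    have c: "fst \<beta> \<in> carrier R1" "snd \<beta> \<in> carrier R2"
      "fst \<alpha> \<in> carrier R1" "snd \<alpha> \<in> carrier R2" "fst \<gamma> \<in> carrier R1" "snd \<gamma> \<in> carrier R2"
      using \<beta> red by (auto simp: prod_red_def RDirProd_carrier)
    interpret I1: ideal "Idl\<^bsub>R1\<^esub> {fst \<beta>}" R1
      using c by (intro R1.genideal_ideal) auto
    interpret I2: ideal "Idl\<^bsub>R2\<^esub> {snd \<beta>}" R2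
      using c by (intro R2.genideal_ideal) auto
    \<comment> \<open>A coordinate left unchanged contributes the difference 0, which lies in every
      ideal.\<close>
    have diff: "fst \<gamma> \<ominus>\<^bsub>R1\<^esub> fst \<gamma> = \<zero>\<^bsub>R1\<^esub>" "snd \<gamma> \<ominus>\<^bsub>R2\<^esub> snd \<gamma> = \<zero>\<^bsub>R2\<^esub>"
      using c by simp_all
    have "fst \<alpha> \<ominus>\<^bsub>R1\<^esub> fst \<gamma> \<in> Idl\<^bsub>R1\<^esub> {fst \<beta>}"
      using red c R1.red_diff_in_ideal[OF c(1)] by (auto simp: prod_red_def diff)
    moreover have "snd \<alpha> \<ominus>\<^bsub>R2\<^esub> snd \<gamma> \<in> Idl\<^bsub>R2\<^esub> {snd \<beta>}"
      using red c R2.red_diff_in_ideal[OF c(2)] by (auto simp: prod_red_def diff)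
    ultimately show "\<alpha> \<ominus>\<^bsub>RDirProd R1 R2\<^esub> \<gamma> \<in> Idl\<^bsub>RDirProd R1 R2\<^esub> {\<beta>}"
      using c by (simp add: genideal_RDirProd[OF R1.ring_axioms R2.ring_axioms] mem_Times_iff
          RDirProd_minus[OF R1.ring_axioms R2.ring_axioms])
  next
    fix \<alpha>
    assume \<alpha>: "\<alpha> \<in> carrier (RDirProd R1 R2) - {\<zero>\<^bsub>RDirProd R1 R2\<^esub>}"
    \<comment> \<open>Zero coordinates stay put and nonzero ones reduce to 0. As at least one
      coordinate is nonzero, the three remaining cases match the three disjuncts of
      \<open>prod_red\<close>.\<close>
    then show "prod_red R1 R2 red1 red2 \<alpha> \<alpha> \<zero>\<^bsub>RDirProd R1 R2\<^esub>"
      using R1.red_self_zero[of "fst \<alpha>"] R2.red_self_zero[of "snd \<alpha>"]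
      by (cases "fst \<alpha> = \<zero>\<^bsub>R1\<^esub>"; cases "snd \<alpha> = \<zero>\<^bsub>R2\<^esub>")
        (auto simp: prod_red_def RDirProd_zero RDirProd_carrier)
  qed
qed

text \<open>By \<open>not_red_zero\<close>, a reducer \<open>(\<beta>, 0)\<close> can act only on
  the first coordinate and \<open>(0, \<beta>)\<close> only on the second, which rules out
  simultaneous steps.\<close>

lemma red_set_prod_red_axes:
  assumes "reduction_relation R1 red1" and "reduction_relation R2 red2"
    and "G1 \<subseteq> carrier R1" and "G2 \<subseteq> carrier R2"
  shows "red_set (prod_red R1 R2 red1 red2) (G1 \<times> {\<zero>\<^bsub>R2\<^esub>} \<union> {\<zero>\<^bsub>R1\<^esub>} \<times> G2) =
    interleave (carrier R1) (carrier R2) (red_set red1 G1) (red_set red2 G2)"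
proof -
  interpret R1: reduction_relation R1 red1 by fact
  interpret R2: reduction_relation R2 red2 by fact
  show ?thesis
  proof (intro ext iffI)
    fix x y
    assume "red_set (prod_red R1 R2 red1 red2) (G1 \<times> {\<zero>\<^bsub>R2\<^esub>} \<union> {\<zero>\<^bsub>R1\<^esub>} \<times> G2) x y"
    then show "interleave (carrier R1) (carrier R2) (red_set red1 G1) (red_set red2 G2) x y"
      by (auto simp: red_set_def prod_red_def interleave_def RDirProd_carrier
          R1.not_red_zero R2.not_red_zero)
  next
    fix x y
    assume "interleave (carrier R1) (carrier R2) (red_set red1 G1) (red_set red2 G2) x y"
    then consider \<beta> where "\<beta> \<in> G1" "red1 \<beta> (fst x) (fst y)" "snd x = snd y" "snd x \<in> carrier R2"
      | \<beta> where "\<beta> \<in> G2" "red2 \<beta> (snd x) (snd y)" "fst x = fst y" "fst x \<in> carrier R1"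
      by (auto simp: red_set_def interleave_def)
    then show "red_set (prod_red R1 R2 red1 red2) (G1 \<times> {\<zero>\<^bsub>R2\<^esub>} \<union> {\<zero>\<^bsub>R1\<^esub>} \<times> G2) x y"
    proof cases
      case 1
      \<comment> \<open>The moving coordinate lies in its carrier by \<open>red_closed\<close>, the
        resting one by the guard of \<open>interleave\<close>.\<close>
      then have "prod_red R1 R2 red1 red2 (\<beta>, \<zero>\<^bsub>R2\<^esub>) x y"
        using assms(3) R1.red_closed[OF _ 1(2)] by (auto simp: prod_red_def RDirProd_carrier mem_Times_iff)
      then show ?thesis
        using 1 unfolding red_set_def by blast
    next
      case 2
      then have "prod_red R1 R2 red1 red2 (\<zero>\<^bsub>R1\<^esub>, \<beta>) x y"
        using assms(4) R2.red_closed[OF _ 2(2)] by (auto simp: prod_red_def RDirProd_carrier mem_Times_iff)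
      then show ?thesis
        using 2 unfolding red_set_def by blast
    qed
  qed
qed

text \<open>The axes are used instead of \<open>G1 \<times> G2\<close> because the latter is empty,
  and so reduces nothing, as soon as one of the two bases is empty.\<close>

lemma groebner_basis_axes:
  assumes "reduction_relation R1 red1" and "reduction_relation R2 red2"
    and G1: "groebner_basis R1 red1 G1 I1" "finite G1"
    and G2: "groebner_basis R2 red2 G2 I2" "finite G2"
  shows "groebner_basis (RDirProd R1 R2) (prod_red R1 R2 red1 red2)
    (G1 \<times> {\<zero>\<^bsub>R2\<^esub>} \<union> {\<zero>\<^bsub>R1\<^esub>} \<times> G2) (I1 \<times> I2)"
proof -
  interpret R1: reduction_relation R1 red1 by fact
  interpret R2: reduction_relation R2 red2 by fact
  interpret P: reduction_relation "RDirProd R1 R2" "prod_red R1 R2 red1 red2"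
    by (rule reduction_relation_prod_red) fact+
  let ?G = "G1 \<times> {\<zero>\<^bsub>R2\<^esub>} \<union> {\<zero>\<^bsub>R1\<^esub>} \<times> G2"
  have sub: "G1 \<subseteq> carrier R1" "G2 \<subseteq> carrier R2"
    using G1 G2 by (auto simp: groebner_basis_def)
  then have G: "?G \<subseteq> carrier R1 \<times> carrier R2"
    by auto
  note red_eq = red_set_prod_red_axes[OF assms(1,2) sub]
  note on1 = R1.relation_on_red_set[OF sub(1)] and on2 = R2.relation_on_red_set[OF sub(2)]
  have "Idl\<^bsub>R1\<^esub> (fst ` ?G) = Idl\<^bsub>R1\<^esub> G1" "Idl\<^bsub>R2\<^esub> (snd ` ?G) = Idl\<^bsub>R2\<^esub> G2"
  proof -
    \<comment> \<open>The other axis projects to 0 if its basis is nonempty and contributes nothing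
      otherwise.\<close>
    have "fst ` ?G = (if G2 = {} then G1 else insert \<zero>\<^bsub>R1\<^esub> G1)"
      "snd ` ?G = (if G1 = {} then G2 else insert \<zero>\<^bsub>R2\<^esub> G2)"
      by force+
    then show "Idl\<^bsub>R1\<^esub> (fst ` ?G) = Idl\<^bsub>R1\<^esub> G1" "Idl\<^bsub>R2\<^esub> (snd ` ?G) = Idl\<^bsub>R2\<^esub> G2"
      using R1.genideal_insert_zero[OF sub(1)] R2.genideal_insert_zero[OF sub(2)] by simp_all
  qed
  then have "I1 \<times> I2 = Idl\<^bsub>RDirProd R1 R2\<^esub> ?G"
    using G1 G2 by (simp add: genideal_RDirProd[OF R1.ring_axioms R2.ring_axioms G] groebner_basis_def)
  \<comment> \<open>Both sides split by coordinates: convertibility through the interleaving, and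
    membership of the difference because subtraction is componentwise.\<close>
  moreover have "equivclp (red_set (prod_red R1 R2 red1 red2) ?G) \<alpha> \<beta> \<longleftrightarrow>
      \<alpha> \<ominus>\<^bsub>RDirProd R1 R2\<^esub> \<beta> \<in> I1 \<times> I2"
    if "\<alpha> \<in> carrier R1 \<times> carrier R2" "\<beta> \<in> carrier R1 \<times> carrier R2" for \<alpha> \<beta>
    using that G1 G2
    by (auto simp: red_eq equivclp_interleave_iff[OF on1] groebner_basis_def
        RDirProd_minus[OF R1.ring_axioms R2.ring_axioms])
  moreover have "confluentp (red_set (prod_red R1 R2 red1 red2) ?G)"
    using G1 G2 confluentp_interleave[OF on1 on2]
    by (simp add: red_eq groebner_basis_def complete_red_def)
  \<comment> \<open>Finiteness of \<open>G1\<close> and \<open>G2\<close> enters here: the axes form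
    a finite set, to which the termination axiom already proved for the product applies.\<close>
  moreover have "terminating (red_set (prod_red R1 R2 red1 red2) ?G)"
    using G G1 G2 by (intro P.red_terminating) (auto simp: RDirProd_carrier)
  ultimately show ?thesis
    using G by (simp add: groebner_basis_def complete_red_def RDirProd_carrier)
qed

theorem theorem3p3p2:
  fixes R1 :: "('a, 'm) ring_scheme" and R2 :: "('b, 'n) ring_scheme"
    and red1 :: "'a \<Rightarrow> 'a \<Rightarrow> 'a \<Rightarrow> bool" and red2 :: "'b \<Rightarrow> 'b \<Rightarrow> 'b \<Rightarrow> bool"
  assumes "reduction_ring R1 red1" and "reduction_ring R2 red2"
  shows "reduction_ring (RDirProd R1 R2) (prod_red R1 R2 red1 red2)"
proof -
  interpret R1: reduction_ring R1 red1 by fact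
  interpret R2: reduction_ring R2 red2 by fact
  note rel = R1.reduction_relation_axioms R2.reduction_relation_axioms
  interpret P: reduction_relation "RDirProd R1 R2" "prod_red R1 R2 red1 red2"
    by (rule reduction_relation_prod_red[OF rel])
  show ?thesis
  proof
    fix F
    assume F: "F \<subseteq> carrier (RDirProd R1 R2)" "finite F"
    then have F': "F \<subseteq> carrier R1 \<times> carrier R2"
      by (simp add: RDirProd_carrier)
    then have "fst ` F \<subseteq> carrier R1" "snd ` F \<subseteq> carrier R2"
      by auto
    \<comment> \<open>The bases are taken for the ideals of the two projections of \<open>F\<close>,
      since by \<open>genideal_RDirProd\<close> the product of these ideals is the ideal generated
      by \<open>F\<close>.\<close>
    then obtain G1 G2
      where G1: "finite G1" "groebner_basis R1 red1 G1 (Idl\<^bsub>R1\<^esub> (fst ` F))"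
        and G2: "finite G2" "groebner_basis R2 red2 G2 (Idl\<^bsub>R2\<^esub> (snd ` F))"
      using R1.finite_groebner_basis R2.finite_groebner_basis F(2) by (meson finite_imageI)
    show "\<exists>G. finite G \<and> groebner_basis (RDirProd R1 R2) (prod_red R1 R2 red1 red2) G
        (Idl\<^bsub>RDirProd R1 R2\<^esub> F)"
      unfolding genideal_RDirProd[OF R1.ring_axioms R2.ring_axioms F']
      using groebner_basis_axes[OF rel G1(2,1) G2(2,1)] G1(1) G2(1)
      by (intro exI[of _ "G1 \<times> {\<zero>\<^bsub>R2\<^esub>} \<union> {\<zero>\<^bsub>R1\<^esub>} \<times> G2"]) simp
  qed
qed

end
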